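(* Let $\sigma_{\widehat{\mathrm{mex}}}(n)$ denote the sum of $\widehat{\mathrm{mex}}(\pi)$ over all overpartitions $\pi$ of $n$ (for $n\ge 1$), with $\sigma_{\widehat{\mathrm{mex}}}(0)=1$. Then, as formal power series in $q$, \[\sum_{n=0}^\infty \sigma_{\widehat{\mathrm{mex}}}(n)\, q^n=\frac{(-q;q)_\infty}{(q;q)_\infty}\sum_{m=0}^\infty \frac{m\,q^{\binom{m}{2}}}{(-q;q)_m}=\overline{P}(q)\,\sigma(q),\] where $\overline{P}(q)=\sum_{n\ge 0}\overline{p}(n)q^n=\frac{(-q;q)_\infty}{(q;q)_\infty}$ is the generating function of the overpartition numbers and $\sigma(q)=\sum_{m=0}^\infty \frac{q^{\binom{m+1}{2}}}{(-q;q)_m}$ is Ramanujan's $q$-series.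
   Context: An overpartition of a positive integer $n$ is a non-increasing sequence of positive integers summing to $n$ in which the first occurrence of each number may (or may not) be overlined; $\overline{p}(n)$ is the number of overpartitions of $n$ ($\overline{p}(0)=1$). For an overpartition $\pi$, $\widehat{\mathrm{mex}}(\pi)$ (the minimal excludant of the overlined parts) is the smallest positive integer that does not occur as an overlined part of $\pi$. Notation: $(a;q)_m=\prod_{k=0}^{m-1}(1-aq^k)$ and $(a;q)_\infty=\prod_{k=0}^{\infty}(1-aq^k)$. *)

theory Defs
  imports "HOL-Analysis.Infinite_Products"
    "HOL-Computational_Algebra.Formal_Power_Series"
begin

text \<open>An overpartition is the list of its parts; the Boolean component of a part records
  whether it is overlined.\<close>

definition is_overpartition :: "nat \<Rightarrow> (nat \<times> bool) list \<Rightarrow> bool" where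
  "is_overpartition n \<pi> \<longleftrightarrow>
     (\<forall>x\<in>set \<pi>. 0 < fst x) \<and>
     sorted_wrt (\<lambda>x y. fst x \<ge> fst y) \<pi> \<and>
     sum_list (map fst \<pi>) = n \<and>
     (\<forall>i<length \<pi>. snd (\<pi> ! i) \<longrightarrow> (\<forall>j<i. fst (\<pi> ! j) \<noteq> fst (\<pi> ! i)))"

definition overpartitions :: "nat \<Rightarrow> (nat \<times> bool) list set" where
  "overpartitions n = {\<pi>. is_overpartition n \<pi>}"

definition overpartition_count :: "nat \<Rightarrow> nat" where
  "overpartition_count n = (if n = 0 then 1 else card (overpartitions n))"

definition mex_overlined :: "(nat \<times> bool) list \<Rightarrow> nat" where
  "mex_overlined \<pi> = (LEAST k. 0 < k \<and> (k, True) \<notin> set \<pi>)"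

definition sigma_mex :: "nat \<Rightarrow> nat" where
  "sigma_mex n = (if n = 0 then 1 else (\<Sum>\<pi>\<in>overpartitions n. mex_overlined \<pi>))"

definition qpoch :: "'a::comm_ring_1 \<Rightarrow> 'a \<Rightarrow> nat \<Rightarrow> 'a" where
  "qpoch a q m = (\<Prod>k<m. 1 - a * q ^ k)"

text \<open>On formal power series, the infinite product and the infinite sums below are limits in
  the metric of \<^theory>\<open>HOL-Computational_Algebra.Formal_Power_Series\<close>, that is,
  coefficientwise eventually constant limits. Rational coefficients are used because division of
  power series needs a field of coefficients.\<close>

definition qpoch_inf :: "rat fps \<Rightarrow> rat fps \<Rightarrow> rat fps" where
  "qpoch_inf a q = (\<Prod>k. 1 - a * q ^ k)"

definition overpartition_gf :: "rat fps" where
  "overpartition_gf = Abs_fps (\<lambda>n. of_nat (overpartition_count n))"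

definition ramanujan_sigma :: "rat fps" where
  "ramanujan_sigma = (\<Sum>m. fps_X ^ ((m + 1) choose 2) / qpoch (- fps_X) fps_X m)"

text \<open>Finiteness ensures that the cardinality and the sum over all overpartitions are not the
  default values for infinite sets; the lemmas for \<open>n = 0\<close> show that the conventions at 0 agree
  with counting the empty overpartition.\<close>

lemma finite_overpartitions: "finite (overpartitions n)"
proof (rule finite_subset)
  show "overpartitions n \<subseteq> {\<pi>. set \<pi> \<subseteq> {..n} \<times> UNIV \<and> length \<pi> \<le> n}"
  proof
    fix \<pi> assume "\<pi> \<in> overpartitions n"
    then have pos: "\<forall>x\<in>set \<pi>. 0 < fst x" and s: "sum_list (map fst \<pi>) = n"
      by (auto simp: overpartitions_def is_overpartition_def)
    have "length \<pi> \<le> sum_list (map fst \<pi>)"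
      using pos
    proof (induction \<pi>)
      case (Cons x xs)
      then have "0 < fst x" "length xs \<le> sum_list (map fst xs)" by auto
      then show ?case by simp
    qed simp
    moreover have "fst x \<le> n" if "x \<in> set \<pi>" for x
      using that s member_le_sum_list[of "fst x" "map fst \<pi>"] by auto
    ultimately show "\<pi> \<in> {\<pi>. set \<pi> \<subseteq> {..n} \<times> UNIV \<and> length \<pi> \<le> n}"
      using s by (auto simp: mem_Times_iff)
  qed
  show "finite {\<pi>::(nat \<times> bool) list. set \<pi> \<subseteq> {..n} \<times> UNIV \<and> length \<pi> \<le> n}"
    by (rule finite_lists_length_le) simp
qed

lemma overpartitions_0: "overpartitions 0 = {[]}"
proof -
  have "\<pi> = []" if "is_overpartition 0 \<pi>" for \<pi>
    using that by (cases \<pi>) (auto simp: is_overpartition_def)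
  then show ?thesis
    by (auto simp: overpartitions_def is_overpartition_def)
qed

lemma mex_overlined_Nil: "mex_overlined [] = 1"
  unfolding mex_overlined_def by (rule Least_equality) auto

end

theory Submission
  imports Defs
begin

text \<open>For each \<open>m\<close>, the overpartitions in which all of \<open>1, \<dots>, m\<close> occur overlined, that is, those
  with \<open>mex > m\<close>, have the generating function
  \<open>q^(m+1 choose 2) (-q^(m+1);q)\<^sub>\<infinity> / (q;q)\<^sub>\<infinity>\<close>; since the mex is the number of \<open>m\<close> below it,
  summing over \<open>m\<close> gives \<open>\<sigma>\<close> times the overpartition series. With
  \<open>s\<^sub>m = q^(m+1 choose 2) / (-q;q)\<^sub>m\<close> we have \<open>q^(m choose 2) / (-q;q)\<^sub>m = s\<^sub>m\<^sub>-\<^sub>1 - s\<^sub>m\<close>, so summation by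
  parts yields the other series. The generating functions are obtained by bounding the largest
  part by \<open>N\<close>, removing that part from the list, and letting \<open>N\<close> tend to infinity.\<close>

unbundle no vec_syntax
unbundle fps_syntax

section \<open>Coefficientwise limits of power series\<close>

lemma tendsto_mult_fps:
  fixes f g :: "'b \<Rightarrow> 'a::ring_1 fps"
  assumes "(f \<longlongrightarrow> a) F" "(g \<longlongrightarrow> b) F"
  shows "((\<lambda>x. f x * g x) \<longlongrightarrow> a * b) F"
proof (rule tendsto_fpsI)
  fix n
  have "eventually (\<lambda>x. \<forall>i\<in>{..n}. f x $ i = a $ i) F" "eventually (\<lambda>x. \<forall>i\<in>{..n}. g x $ i = b $ i) F"
    using assms by (auto simp: eventually_ball_finite_distrib tendsto_fps_iff)
  then show "eventually (\<lambda>x. (f x * g x) $ n = (a * b) $ n) F"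
    by eventually_elim (auto simp: fps_mult_nth intro!: sum.cong)
qed

text \<open>Once more than \<open>n\<close> terms are added, coefficient \<open>n\<close> no longer
  changes, so the limit is read off coefficientwise as a finite sum.\<close>

lemma sums_fpsI:
  fixes f :: "nat \<Rightarrow> 'a::ring_1 fps"
  assumes "\<And>m n. n < m \<Longrightarrow> f m $ n = 0"
  shows "f sums Abs_fps (\<lambda>n. \<Sum>m\<le>n. f m $ n)"
  unfolding sums_def
proof (rule tendsto_fpsI)
  fix n
  show "\<forall>\<^sub>F N in sequentially. (\<Sum>m<N. f m) $ n = Abs_fps (\<lambda>n. \<Sum>m\<le>n. f m $ n) $ n"
    using eventually_gt_at_top[of n]
  proof eventually_elim
    case (elim N)
    then have "(\<Sum>m<N. f m $ n) = (\<Sum>m\<le>n. f m $ n)"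
      using assms by (intro sum.mono_neutral_right) auto
    then show ?case by (simp add: fps_sum_nth)
  qed
qed

section \<open>Finite and infinite \<open>q\<close>-Pochhammer products\<close>

lemma qpoch_Suc: "qpoch a q (Suc m) = qpoch a q m * (1 - a * q ^ m)"
  by (simp add: qpoch_def)

lemma fps_nth_prod_0: "(\<Prod>k\<in>A. f k :: 'a::comm_ring_1 fps) $ 0 = (\<Prod>k\<in>A. f k $ 0)"
  by (induction A rule: infinite_finite_induct) auto

lemma qpoch_nth_0: "qpoch (c * fps_X) fps_X m $ 0 = (1 :: 'a::comm_ring_1)"
  by (simp add: qpoch_def fps_nth_prod_0)

text \<open>The factor with index \<open>N\<close> is \<open>1 - c * fps_X ^ Suc N\<close>, so it
  alters only coefficients of index above \<open>N\<close>. The base \<open>c * fps_X\<close> covers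
  both products at once, with \<open>c = 1\<close> and \<open>c = -1\<close>.\<close>

lemma qpoch_nth_stable:
  fixes c :: "'a::comm_ring_1 fps"
  assumes "n \<le> N"
  shows "qpoch (c * fps_X) fps_X N $ n = qpoch (c * fps_X) fps_X n $ n"
  using assms
proof (induction N rule: dec_induct)
  case (step N)
  have "qpoch (c * fps_X) fps_X (Suc N) =
      qpoch (c * fps_X) fps_X N - fps_X ^ Suc N * (c * qpoch (c * fps_X) fps_X N)"
    by (simp add: qpoch_Suc algebra_simps)
  with step show ?case by (simp add: fps_X_power_mult_nth del: power_Suc)
qed simp

lemma raw_has_prod_qpoch:
  fixes c :: "rat fps"
  shows "raw_has_prod (\<lambda>k. 1 - c * fps_X * fps_X ^ k) 0
    (Abs_fps (\<lambda>n. qpoch (c * fps_X) fps_X n $ n))" (is "raw_has_prod _ 0 ?P")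
proof -
  have "(\<lambda>n. \<Prod>k\<le>n. 1 - c * fps_X * fps_X ^ k) \<longlonglongrightarrow> ?P"
  proof (rule tendsto_fpsI)
    fix n
    show "\<forall>\<^sub>F N in sequentially. (\<Prod>k\<le>N. 1 - c * fps_X * fps_X ^ k) $ n = ?P $ n"
      using eventually_ge_at_top[of n]
      by eventually_elim
        (use qpoch_nth_stable[of n "Suc _" c] in \<open>simp add: qpoch_def lessThan_Suc_atMost\<close>)
  qed
  \<comment> \<open>\<open>raw_has_prod\<close> also demands a nonzero limit; the constant
    coefficient shows this.\<close>
  moreover have "?P $ 0 = 1" by (simp add: qpoch_def)
  then have "?P \<noteq> 0" by (metis fps_zero_nth zero_neq_one)
  ultimately show ?thesis by (simp add: raw_has_prod_def)
qed

lemma convergent_prod_qpoch: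
  "convergent_prod (\<lambda>k. 1 - c * fps_X * fps_X ^ k :: rat fps)"
  using raw_has_prod_qpoch convergent_prod_def by blast

lemma qpoch_inf_eq:
  "qpoch_inf (c * fps_X) fps_X = Abs_fps (\<lambda>n. qpoch (c * fps_X) fps_X n $ n)"
  unfolding qpoch_inf_def
  by (rule has_prod_unique[symmetric]) (use raw_has_prod_qpoch in \<open>auto simp: has_prod_def\<close>)

lemma qpoch_inf_nth_0: "qpoch_inf (c * fps_X) fps_X $ 0 = 1"
  by (simp add: qpoch_inf_eq qpoch_def)

lemma qpoch_tendsto: "(\<lambda>N. qpoch (c * fps_X) fps_X N) \<longlonglongrightarrow> qpoch_inf (c * fps_X) fps_X"
  unfolding qpoch_inf_eq
proof (rule tendsto_fpsI)
  fix n
  show "\<forall>\<^sub>F N in sequentially. qpoch (c * fps_X) fps_X N $ n =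
      Abs_fps (\<lambda>n. qpoch (c * fps_X) fps_X n $ n) $ n"
    using eventually_ge_at_top[of n] by eventually_elim (simp, rule qpoch_nth_stable)
qed

section \<open>Overpartitions with prescribed overlined parts\<close>

lemma is_overpartition_Nil: "is_overpartition n [] \<longleftrightarrow> n = 0"
  by (auto simp: is_overpartition_def)

text \<open>The head is the first occurrence of \<open>k\<close>, so its flag \<open>b\<close> is
  free. Every further \<open>k\<close> in the tail is a later occurrence and hence must be
  plain.\<close>

lemma is_overpartition_Cons:
  "is_overpartition n ((k, b) # \<pi>) \<longleftrightarrow>
     0 < k \<and> k \<le> n \<and> is_overpartition (n - k) \<pi> \<and> (\<forall>x\<in>set \<pi>. fst x \<le> k) \<and> (k, True) \<notin> set \<pi>"
proof -
  have "(\<forall>i<length ((k, b) # \<pi>). snd (((k, b) # \<pi>) ! i) \<longrightarrow>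
          (\<forall>j<i. fst (((k, b) # \<pi>) ! j) \<noteq> fst (((k, b) # \<pi>) ! i))) \<longleftrightarrow>
      (\<forall>i<length \<pi>. snd (\<pi> ! i) \<longrightarrow> k \<noteq> fst (\<pi> ! i) \<and> (\<forall>j<i. fst (\<pi> ! j) \<noteq> fst (\<pi> ! i)))"
    by (simp add: All_less_Suc2)
  moreover have "(k, True) \<notin> set \<pi> \<longleftrightarrow> (\<forall>i<length \<pi>. snd (\<pi> ! i) \<longrightarrow> k \<noteq> fst (\<pi> ! i))"
    by (auto simp: in_set_conv_nth prod_eq_iff)
  ultimately show ?thesis
    unfolding is_overpartition_def by auto
qed

definition overpartitions_over :: "nat set \<Rightarrow> nat \<Rightarrow> (nat \<times> bool) list set" where
  "overpartitions_over D n = {\<pi> \<in> overpartitions n. \<forall>k\<in>D. (k, True) \<in> set \<pi>}"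

text \<open>Only the elements of \<open>D\<close> up to \<open>N\<close> are compulsory, so that the
  recursion on \<open>N\<close> starts from the empty overpartition even if \<open>D\<close>
  contains larger numbers.\<close>

definition bounded_over :: "nat set \<Rightarrow> nat \<Rightarrow> nat \<Rightarrow> (nat \<times> bool) list set" where
  "bounded_over D N n =
     {\<pi> \<in> overpartitions_over (D \<inter> {..N}) n. \<forall>x\<in>set \<pi>. fst x \<le> N}"

text \<open>These are the tails that can remain after removing a largest part \<open>Suc N\<close>, which may be
  overlined only at its first occurrence.\<close>

definition bounded_over_plain :: "nat set \<Rightarrow> nat \<Rightarrow> nat \<Rightarrow> (nat \<times> bool) list set" where
  "bounded_over_plain D N n =
     {\<pi> \<in> overpartitions_over (D \<inter> {..N}) n.
       (\<forall>x\<in>set \<pi>. fst x \<le> Suc N) \<and> (Suc N, True) \<notin> set \<pi>}"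

lemmas bounded_over_defs =
  bounded_over_def bounded_over_plain_def overpartitions_over_def overpartitions_def

lemma finite_overpartitions_over: "finite (overpartitions_over D n)"
  using finite_overpartitions[of n] by (auto simp: overpartitions_over_def)

lemma finite_bounded_over: "finite (bounded_over D N n)" "finite (bounded_over_plain D N n)"
  using finite_overpartitions_over[of "D \<inter> {..N}" n]
  by (auto simp: bounded_over_def bounded_over_plain_def)

text \<open>Either no part equals \<open>Suc N\<close>, or the list starts with a plain
  \<open>Suc N\<close>; removing it leaves a list of the same kind, since further plain copies may
  follow.\<close>

lemma bounded_over_plain_rec:
  "bounded_over_plain D N n = bounded_over D N n \<union>
     (if n < Suc N then {} else Cons (Suc N, False) ` bounded_over_plain D N (n - Suc N))"
  (is "?L = ?R")
proof (rule set_eqI)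
  fix \<pi>
  show "\<pi> \<in> ?L \<longleftrightarrow> \<pi> \<in> ?R"
  proof (cases \<pi>)
    case Nil
    then show ?thesis by (auto simp: bounded_over_defs is_overpartition_Nil)
  next
    case (Cons x xs)
    obtain k b where x: "x = (k, b)" by fastforce
    show ?thesis
    proof (cases "k = Suc N")
      case True
      then show ?thesis
        unfolding Cons x by (auto simp: bounded_over_defs is_overpartition_Cons image_iff)
    next
      case False
      then have "(Suc N, True) \<notin> set \<pi>" if "\<forall>y\<in>set xs. fst y \<le> k" "k \<le> N"
        using that unfolding Cons x by auto
      moreover have "\<forall>y\<in>set xs. fst y \<le> N" if "\<forall>y\<in>set xs. fst y \<le> k" "k \<le> N"
        using that le_trans by blast
      ultimately show ?thesis
        using False unfolding Cons x
        by (auto simp: bounded_over_defs is_overpartition_Cons image_iff le_Suc_eq)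
    qed
  qed
qed

text \<open>The split is by whether \<open>Suc N\<close> occurs overlined. If it does, it is the
  head, being a largest part at its first occurrence. If \<open>Suc N\<close> is in
  \<open>D\<close>, only this case remains.\<close>

lemma bounded_over_Suc_rec:
  "bounded_over D (Suc N) n = (if Suc N \<in> D then {} else bounded_over_plain D N n) \<union>
     (if n < Suc N then {} else Cons (Suc N, True) ` bounded_over_plain D N (n - Suc N))"
  (is "?L = ?R")
proof (rule set_eqI)
  fix \<pi>
  show "\<pi> \<in> ?L \<longleftrightarrow> \<pi> \<in> ?R"
  proof (cases \<pi>)
    case Nil
    then show ?thesis
      by (auto simp: bounded_over_defs is_overpartition_Nil atMost_Suc)
  next
    case (Cons x xs)
    obtain k b where x: "x = (k, b)" by fastforce
    show ?thesis
    proof (cases "k = Suc N")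
      case True
      then show ?thesis
        unfolding Cons x
        by (cases b) (auto simp: bounded_over_defs is_overpartition_Cons image_iff atMost_Suc)
    next
      case False
      then have "(Suc N, True) \<notin> set \<pi>"
        if "\<forall>y\<in>set xs. fst y \<le> k" "k \<le> Suc N"
        using that unfolding Cons x by auto
      with False show ?thesis
        unfolding Cons x
        by (auto simp: bounded_over_defs is_overpartition_Cons image_iff atMost_Suc)
    qed
  qed
qed

lemma card_bounded_over_plain:
  "card (bounded_over_plain D N n) = card (bounded_over D N n) +
     (if n < Suc N then 0 else card (bounded_over_plain D N (n - Suc N)))"
  by (subst bounded_over_plain_rec, subst card_Un_disjoint)
    (simp_all add: finite_bounded_over card_image, auto simp: bounded_over_defs)

lemma card_bounded_over_Suc:
  "card (bounded_over D (Suc N) n) = (if Suc N \<in> D then 0 else card (bounded_over_plain D N n)) +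
     (if n < Suc N then 0 else card (bounded_over_plain D N (n - Suc N)))"
  by (subst bounded_over_Suc_rec, subst card_Un_disjoint)
    (simp_all add: finite_bounded_over card_image, auto simp: bounded_over_defs)

section \<open>Generating functions with bounded largest part\<close>

definition bounded_over_gf :: "nat set \<Rightarrow> nat \<Rightarrow> rat fps" where
  "bounded_over_gf D N = Abs_fps (\<lambda>n. of_nat (card (bounded_over D N n)))"

lemma bounded_over_gf_0: "0 \<notin> D \<Longrightarrow> bounded_over_gf D 0 = 1"
proof (rule fps_ext)
  fix n assume D: "0 \<notin> D"
  have "bounded_over D 0 n = (if n = 0 then {[]} else {})"
  proof (rule set_eqI)
    fix \<pi>
    show "\<pi> \<in> bounded_over D 0 n \<longleftrightarrow> \<pi> \<in> (if n = 0 then {[]} else {})"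
      using D
      by (cases \<pi>) (auto simp: bounded_over_defs is_overpartition_Nil is_overpartition_Cons)
  qed
  then show "bounded_over_gf D 0 $ n = 1 $ n" by (simp add: bounded_over_gf_def)
qed

text \<open>The two recursions express \<open>bounded_over_gf D N\<close> as
  \<open>(1 - fps_X ^ Suc N) * B\<close> and \<open>bounded_over_gf D (Suc N)\<close> as
  \<open>(e + fps_X ^ Suc N) * B\<close>, with \<open>B\<close> counting the plain tails.
  Cross-multiplying eliminates \<open>B\<close> without division.\<close>

lemma bounded_over_gf_Suc:
  "(1 - fps_X ^ Suc N) * bounded_over_gf D (Suc N) =
     ((if Suc N \<in> D then 0 else 1) + fps_X ^ Suc N) * bounded_over_gf D N"
proof -
  define B :: "rat fps" where "B = Abs_fps (\<lambda>n. of_nat (card (bounded_over_plain D N n)))"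
  \<comment> \<open>The summand \<open>e\<close> stands for \<open>Suc N\<close> not being
    overlined, which is impossible when \<open>Suc N\<close> is in \<open>D\<close>.\<close>
  define e :: "rat fps" where "e = (if Suc N \<in> D then 0 else 1)"
  have 1: "bounded_over_gf D N = (1 - fps_X ^ Suc N) * B"
  proof -
    have "B = bounded_over_gf D N + fps_X ^ Suc N * B"
      by (rule fps_ext) (subst B_def, simp add: B_def bounded_over_gf_def fps_X_power_mult_nth
        card_bounded_over_plain[of D N] del: power_Suc)
    then show ?thesis by (simp add: algebra_simps)
  qed
  have 2: "bounded_over_gf D (Suc N) = (e + fps_X ^ Suc N) * B"
    by (rule fps_ext) (simp add: B_def e_def bounded_over_gf_def fps_X_power_mult_nth
        card_bounded_over_Suc distrib_right del: power_Suc)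
  show ?thesis unfolding e_def[symmetric] 1 2 by (simp only: mult_ac)
qed

abbreviation "poch_plus \<equiv> qpoch (- fps_X) fps_X :: nat \<Rightarrow> rat fps"
abbreviation "poch_minus \<equiv> qpoch fps_X fps_X :: nat \<Rightarrow> rat fps"

lemma poch_Suc:
  "poch_plus (Suc m) = poch_plus m * (1 + fps_X ^ Suc m)"
  "poch_minus (Suc m) = poch_minus m * (1 - fps_X ^ Suc m)"
  by (simp_all add: qpoch_Suc)

lemma Suc_choose_two: "(Suc m + 1) choose 2 = Suc m + (m + 1 choose 2)"
  by (simp add: numeral_2_eq_2)

text \<open>As long as every part size must occur overlined, each step contributes only the monomial
  \<open>fps_X ^ Suc N\<close>; the exponents 1, ..., \<open>N\<close> add up to the triangular
  number.\<close>

lemma bounded_over_gf_small: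
  "N \<le> m \<Longrightarrow> poch_minus N * bounded_over_gf {1..m} N = fps_X ^ ((N + 1) choose 2)"
proof (induction N)
  case 0
  then show ?case by (simp add: qpoch_def bounded_over_gf_0 binomial_eq_0)
next
  case (Suc N)
  have "poch_minus (Suc N) * bounded_over_gf {1..m} (Suc N) =
      poch_minus N * ((1 - fps_X ^ Suc N) * bounded_over_gf {1..m} (Suc N))"
    by (simp only: poch_Suc mult_ac)
  also have "\<dots> = fps_X ^ Suc N * (poch_minus N * bounded_over_gf {1..m} N)"
    unfolding bounded_over_gf_Suc using Suc.prems by simp
  also have "\<dots> = fps_X ^ ((Suc N + 1) choose 2)"
    using Suc by (simp only: Suc_choose_two power_add Suc_leD)
  finally show ?case .
qed

text \<open>Beyond \<open>m\<close> overlining is optional, so each step contributes a factor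
  \<open>1 + fps_X ^ Suc N\<close>, extending \<open>poch_plus m\<close> to
  \<open>poch_plus N\<close>. The factor \<open>poch_plus m\<close> on the left avoids a
  quotient.\<close>

lemma bounded_over_gf_large:
  assumes "m \<le> N"
  shows "poch_minus N * bounded_over_gf {1..m} N * poch_plus m =
    fps_X ^ ((m + 1) choose 2) * poch_plus N"
  using assms
proof (induction N rule: dec_induct)
  case base
  then show ?case by (simp only: bounded_over_gf_small order_refl)
next
  case (step N)
  have "poch_minus (Suc N) * bounded_over_gf {1..m} (Suc N) * poch_plus m =
      poch_minus N * ((1 - fps_X ^ Suc N) * bounded_over_gf {1..m} (Suc N)) * poch_plus m"
    by (simp only: poch_Suc mult_ac)
  also have "\<dots> = (1 + fps_X ^ Suc N) * (poch_minus N * bounded_over_gf {1..m} N * poch_plus m)"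
    unfolding bounded_over_gf_Suc using step.hyps by (simp add: mult_ac)
  also have "\<dots> = fps_X ^ ((m + 1) choose 2) * poch_plus (Suc N)"
    unfolding step.IH poch_Suc by (simp only: mult_ac)
  finally show ?case .
qed

section \<open>Removing the bound on the largest part\<close>

definition over_gf :: "nat \<Rightarrow> rat fps" where
  "over_gf m = Abs_fps (\<lambda>n. of_nat (card (overpartitions_over {1..m} n)))"

lemma is_overpartition_le: "is_overpartition n \<pi> \<Longrightarrow> x \<in> set \<pi> \<Longrightarrow> fst x \<le> n"
  using member_le_sum_list[of "fst x" "map fst \<pi>"] by (auto simp: is_overpartition_def)

lemma bounded_over_gf_tendsto: "bounded_over_gf {1..m} \<longlonglongrightarrow> over_gf m"
proof (rule tendsto_fpsI)
  fix n
  show "\<forall>\<^sub>F N in sequentially. bounded_over_gf {1..m} N $ n = over_gf m $ n"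
    \<comment> \<open>For \<open>N\<close> at least \<open>n\<close> the bound on the parts is
      vacuous; for \<open>N\<close> at least \<open>m\<close> all of 1, ..., \<open>m\<close> are
      compulsory.\<close>
    using eventually_ge_at_top[of "max m n"]
  proof eventually_elim
    case (elim N)
    then have "bounded_over {1..m} N n = overpartitions_over {1..m} n"
      by (fastforce simp: bounded_over_defs dest: is_overpartition_le)
    then show ?case by (simp add: bounded_over_gf_def over_gf_def)
  qed
qed

lemma poch_plus_nth_0: "poch_plus m $ 0 = 1"
  using qpoch_nth_0[of "-1" m] by simp

text \<open>The division-free identity for bounded parts passes to the limit; the factors on its
  left are then cancelled, which their constant coefficient 1 permits.\<close>

lemma over_gf_eq:
  "over_gf m = qpoch_inf (- fps_X) fps_X / qpoch_inf fps_X fps_X *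
     (fps_X ^ ((m + 1) choose 2) / poch_plus m)"
proof -
  let ?M = "qpoch_inf fps_X fps_X" and ?P = "qpoch_inf (- fps_X) fps_X"
  have M: "poch_minus \<longlonglongrightarrow> ?M" using qpoch_tendsto[of 1] by simp
  have P: "poch_plus \<longlonglongrightarrow> ?P" using qpoch_tendsto[of "-1"] by simp
  have lhs: "(\<lambda>N. poch_minus N * bounded_over_gf {1..m} N * poch_plus m) \<longlonglongrightarrow> ?M * over_gf m * poch_plus m"
    by (intro tendsto_mult_fps M bounded_over_gf_tendsto tendsto_const)
  have rhs: "(\<lambda>N. fps_X ^ ((m + 1) choose 2) * poch_plus N) \<longlonglongrightarrow> fps_X ^ ((m + 1) choose 2) * ?P"
    by (intro tendsto_mult_fps P tendsto_const)
  have "\<forall>\<^sub>F N in sequentially. poch_minus N * bounded_over_gf {1..m} N * poch_plus m =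
      fps_X ^ ((m + 1) choose 2) * poch_plus N"
    using eventually_ge_at_top[of m] by eventually_elim (rule bounded_over_gf_large)
  from lhs rhs[folded tendsto_cong[OF this]]
  have eq: "?M * over_gf m * poch_plus m = fps_X ^ ((m + 1) choose 2) * ?P"
    by (rule LIMSEQ_unique)
  have nz: "?M $ 0 \<noteq> 0" "poch_plus m $ 0 \<noteq> 0"
    using qpoch_inf_nth_0[of 1] poch_plus_nth_0 by simp_all
  have "over_gf m = (inverse ?M * ?M) * over_gf m * (poch_plus m * inverse (poch_plus m))"
    using nz by (simp add: inverse_mult_eq_1 inverse_mult_eq_1')
  also have "\<dots> = inverse ?M * (?M * over_gf m * poch_plus m) * inverse (poch_plus m)"
    by (simp only: mult_ac)
  finally show ?thesis
    unfolding eq using nz by (simp add: fps_divide_unit mult_ac)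
qed

section \<open>The sum of the minimal excludants\<close>

lemma overpartition_gf_eq: "overpartition_gf = over_gf 0"
  by (rule fps_ext)
    (simp add: overpartition_gf_def over_gf_def overpartition_count_def overpartitions_over_def
      overpartitions_0)

lemma less_mex_overlined_iff: "m < mex_overlined \<pi> \<longleftrightarrow> (\<forall>k\<in>{1..m}. (k, True) \<in> set \<pi>)"
proof -
  \<comment> \<open>Some positive number is not a part at all, so the least element defining the mex
    exists.\<close>
  obtain j where j: "0 < j" "j \<notin> fst ` set \<pi>"
    using ex_new_if_finite[of "insert 0 (fst ` set \<pi>)"] by auto
  let ?P = "\<lambda>k. 0 < k \<and> (k, True) \<notin> set \<pi>"
  have "?P j" using j by force
  then have L: "?P (mex_overlined \<pi>)" unfolding mex_overlined_def by (rule LeastI)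
  show ?thesis
  proof
    assume m: "m < mex_overlined \<pi>"
    show "\<forall>k\<in>{1..m}. (k, True) \<in> set \<pi>"
    proof
      fix k assume k: "k \<in> {1..m}"
      with m have "k < mex_overlined \<pi>" by simp
      then have "\<not> ?P k" unfolding mex_overlined_def by (rule not_less_Least)
      with k show "(k, True) \<in> set \<pi>" by simp
    qed
  next
    assume "\<forall>k\<in>{1..m}. (k, True) \<in> set \<pi>"
    then show "m < mex_overlined \<pi>" using L by (auto simp: not_less[symmetric] Ball_def)
  qed
qed

lemma overpartitions_over_empty: "n < m \<Longrightarrow> overpartitions_over {1..m} n = {}"
proof (rule equals0I)
  fix \<pi> assume "n < m" "\<pi> \<in> overpartitions_over {1..m} n"
  then have "is_overpartition n \<pi>" "(m, True) \<in> set \<pi>"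
    by (auto simp: overpartitions_over_def overpartitions_def)
  with \<open>n < m\<close> show False by (auto dest: is_overpartition_le)
qed

lemma sigma_mex_eq: "sigma_mex n = (\<Sum>m\<le>n. card (overpartitions_over {1..m} n))"
proof -
  \<comment> \<open>The mex is the number of \<open>m\<close> below it. Each positive such
    \<open>m\<close> is a part, hence at most \<open>n\<close>, so the sum may stop at
    \<open>n\<close>.\<close>
  have "mex_overlined \<pi> = (\<Sum>m\<le>n. if \<pi> \<in> overpartitions_over {1..m} n then 1 else 0)"
    if "\<pi> \<in> overpartitions n" for \<pi>
  proof -
    have iff: "\<pi> \<in> overpartitions_over {1..m} n \<longleftrightarrow> m < mex_overlined \<pi>" for m
      using that by (simp add: overpartitions_over_def less_mex_overlined_iff)
    moreover have "m \<le> n" if "m < mex_overlined \<pi>" for m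
      using that overpartitions_over_empty[of n m] iff[of m] by fastforce
    ultimately have "{m. m \<le> n \<and> \<pi> \<in> overpartitions_over {1..m} n} = {..<mex_overlined \<pi>}"
      by auto
    then show ?thesis by (simp add: sum.If_cases Int_def)
  qed
  then have "(\<Sum>\<pi>\<in>overpartitions n. mex_overlined \<pi>) =
      (\<Sum>\<pi>\<in>overpartitions n. \<Sum>m\<le>n. if \<pi> \<in> overpartitions_over {1..m} n then 1 else 0)"
    by simp
  also have "\<dots> = (\<Sum>m\<le>n. \<Sum>\<pi>\<in>overpartitions n. if \<pi> \<in> overpartitions_over {1..m} n then 1 else 0)"
    by (rule sum.swap)
  also have "\<dots> = (\<Sum>m\<le>n. card (overpartitions_over {1..m} n))"
    by (intro sum.cong refl)
      (auto simp: sum.If_cases finite_overpartitions overpartitions_over_def intro!: arg_cong[of _ _ card])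
  \<comment> \<open>For \<open>n = 0\<close> the prescribed value 1 agrees with the empty
    overpartition, counted at \<open>m = 0\<close>.\<close>
  finally show ?thesis
    by (simp add: sigma_mex_def overpartitions_over_def overpartitions_0)
qed

section \<open>The two series for Ramanujan's function\<close>

definition sigma_term :: "nat \<Rightarrow> rat fps" where
  "sigma_term m = fps_X ^ ((m + 1) choose 2) / poch_plus m"

lemma le_choose_two: "m \<le> (m + 1) choose 2"
  using Suc_choose_two[of "m - 1"] by (cases m) auto

lemma sigma_term_nth: "n < m \<Longrightarrow> sigma_term m $ n = 0"
  using le_choose_two[of m]
  by (simp add: sigma_term_def fps_divide_unit poch_plus_nth_0 fps_X_power_mult_nth)

lemma sums_sigma: "sigma_term sums ramanujan_sigma"
proof -
  have "ramanujan_sigma = suminf sigma_term"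
    by (simp add: ramanujan_sigma_def sigma_term_def[abs_def])
  with sums_fpsI[of sigma_term, OF sigma_term_nth] show ?thesis
    by (auto simp: sums_iff)
qed

text \<open>The series of the \<open>over_gf m\<close> is summed in two ways: coefficientwise it
  gives \<open>sigma_mex\<close>, and after extracting the common factor \<open>over_gf 0\<close> it
  gives \<open>ramanujan_sigma\<close>. Limits are unique.\<close>

lemma sigma_mex_gf: "Abs_fps (\<lambda>n. of_nat (sigma_mex n)) = over_gf 0 * ramanujan_sigma"
proof -
  have m: "over_gf m = over_gf 0 * sigma_term m" for m
    by (simp add: over_gf_eq sigma_term_def qpoch_def binomial_eq_0)
  have "over_gf sums Abs_fps (\<lambda>n. \<Sum>m\<le>n. over_gf m $ n)"
    by (rule sums_fpsI) (simp add: over_gf_def overpartitions_over_empty del: One_nat_def)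
  moreover have "Abs_fps (\<lambda>n. \<Sum>m\<le>n. over_gf m $ n) = Abs_fps (\<lambda>n. of_nat (sigma_mex n))"
    by (simp add: over_gf_def sigma_mex_eq)
  ultimately have "over_gf sums Abs_fps (\<lambda>n. of_nat (sigma_mex n))" by simp
  moreover have "over_gf sums (over_gf 0 * ramanujan_sigma)"
    using tendsto_mult_fps[OF tendsto_const sums_sigma[unfolded sums_def], of "over_gf 0"]
    by (simp add: sums_def sum_distrib_left m[symmetric])
  ultimately show ?thesis by (rule sums_unique2)
qed

lemma weighted_term_Suc:
  "of_nat (Suc m) * fps_X ^ (Suc m choose 2) / poch_plus (Suc m) =
     of_nat (Suc m) * (sigma_term m - sigma_term (Suc m))"
proof -
  define Q C P I :: "rat fps" where "Q = fps_X ^ Suc m" and "C = fps_X ^ (Suc m choose 2)"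
    and "P = inverse (poch_plus m)" and "I = inverse (1 + Q)"
  have cancel: "I * (1 + Q) = 1"
    unfolding I_def Q_def by (rule inverse_mult_eq_1) simp
  have poch: "inverse (poch_plus (Suc m)) = P * I"
    by (simp only: poch_Suc(1) fps_inverse_mult P_def I_def Q_def)
  have div: "F / poch_plus k = F * inverse (poch_plus k)" for F k
    by (rule fps_divide_unit) (simp add: poch_plus_nth_0)
  have s: "sigma_term m = C * P"
    by (simp add: sigma_term_def div C_def P_def)
  have s_Suc: "sigma_term (Suc m) = Q * C * (P * I)"
    unfolding sigma_term_def div poch Suc_choose_two power_add Q_def C_def by simp
  \<comment> \<open>The first product is \<open>sigma_term m\<close> with
    \<open>I * (1 + Q) = 1\<close> inserted; the part with \<open>Q\<close> is
    \<open>sigma_term (Suc m)\<close>.\<close>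
  have "C * (P * I) = C * P * (I * (1 + Q)) - Q * C * (P * I)"
    by (simp add: distrib_left mult_ac)
  then have "C * (P * I) = sigma_term m - sigma_term (Suc m)"
    by (simp only: s s_Suc cancel mult_1_right)
  then show ?thesis
    unfolding div poch C_def[symmetric] by (simp only: mult.assoc)
qed

lemma sums_weighted:
  "(\<lambda>m. of_nat m * fps_X ^ (m choose 2) / poch_plus m) sums ramanujan_sigma" (is "?f sums _")
proof -
  \<comment> \<open>Summation by parts: the term at \<open>m = 0\<close> vanishes and the later ones
    are weighted differences, leaving one boundary term.\<close>
  have partial: "(\<Sum>m<Suc N. ?f m) = (\<Sum>m<N. sigma_term m) - of_nat N * sigma_term N" for N
  proof (induction N)
    case (Suc N)
    have "(\<Sum>m<Suc (Suc N). ?f m) = (\<Sum>m<Suc N. ?f m) + ?f (Suc N)" by simp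
    also have "\<dots> = (\<Sum>m<N. sigma_term m) - of_nat N * sigma_term N
        + of_nat (Suc N) * (sigma_term N - sigma_term (Suc N))"
      by (simp only: Suc.IH weighted_term_Suc)
    finally show ?case by (simp add: algebra_simps)
  qed simp
  have "(\<lambda>N. \<Sum>m<Suc N. ?f m) \<longlonglongrightarrow> ramanujan_sigma"
    unfolding partial
  proof (rule tendsto_fpsI)
    fix n
    have "\<forall>\<^sub>F N in sequentially. (\<Sum>m<N. sigma_term m) $ n = ramanujan_sigma $ n"
      using sums_sigma by (simp add: sums_def tendsto_fps_iff)
    with eventually_gt_at_top[of n]
    show "\<forall>\<^sub>F N in sequentially.
        ((\<Sum>m<N. sigma_term m) - of_nat N * sigma_term N) $ n = ramanujan_sigma $ n"
    proof eventually_elim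
      case (elim N)
      \<comment> \<open>The boundary term disappears in the limit, because
        \<open>sigma_term N\<close> has no coefficients below index \<open>N\<close>.\<close>
      then have "(of_nat N * sigma_term N) $ n = 0"
        by (simp add: fps_mult_nth sigma_term_nth)
      with elim show ?case by simp
    qed
  qed
  then show ?thesis
    unfolding sums_def by (rule filterlim_sequentially_Suc[THEN iffD1])
qed

theorem theorem1p2:
  shows "convergent_prod (\<lambda>k. 1 - (- fps_X) * fps_X ^ k :: rat fps) \<and>
    convergent_prod (\<lambda>k. 1 - fps_X * fps_X ^ k :: rat fps) \<and>
    summable (\<lambda>m. of_nat m * fps_X ^ (m choose 2) / qpoch (- fps_X) fps_X m :: rat fps) \<and>
    summable (\<lambda>m. fps_X ^ ((m + 1) choose 2) / qpoch (- fps_X) fps_X m :: rat fps) \<and>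
    overpartition_gf = qpoch_inf (- fps_X) fps_X / qpoch_inf fps_X fps_X \<and>
    Abs_fps (\<lambda>n. of_nat (sigma_mex n)) =
      qpoch_inf (- fps_X) fps_X / qpoch_inf fps_X fps_X *
        (\<Sum>m. of_nat m * fps_X ^ (m choose 2) / qpoch (- fps_X) fps_X m) \<and>
    qpoch_inf (- fps_X) fps_X / qpoch_inf fps_X fps_X *
        (\<Sum>m. of_nat m * fps_X ^ (m choose 2) / qpoch (- fps_X) fps_X m) =
      overpartition_gf * ramanujan_sigma"
proof (intro conjI)
  let ?R = "qpoch_inf (- fps_X) fps_X / qpoch_inf fps_X fps_X"
  \<comment> \<open>At \<open>m = 0\<close> the extra factor in \<open>over_gf_eq\<close> is
    1.\<close>
  have R: "?R = over_gf 0"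
    by (simp add: over_gf_eq qpoch_def binomial_eq_0)
  show "convergent_prod (\<lambda>k. 1 - (- fps_X) * fps_X ^ k :: rat fps)"
    using convergent_prod_qpoch[of "-1"] by simp
  show "convergent_prod (\<lambda>k. 1 - fps_X * fps_X ^ k :: rat fps)"
    using convergent_prod_qpoch[of 1] by simp
  show "summable (\<lambda>m. of_nat m * fps_X ^ (m choose 2) / poch_plus m)"
    using sums_weighted by (rule sums_summable)
  show "summable (\<lambda>m. fps_X ^ ((m + 1) choose 2) / poch_plus m)"
    using sums_sigma by (auto simp: sigma_term_def[abs_def] dest: sums_summable)
  show "overpartition_gf = ?R"
    by (simp only: R overpartition_gf_eq)
  have weighted: "(\<Sum>m. of_nat m * fps_X ^ (m choose 2) / poch_plus m) = ramanujan_sigma"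
    using sums_weighted by (rule sums_unique[symmetric])
  show "Abs_fps (\<lambda>n. of_nat (sigma_mex n)) =
      ?R * (\<Sum>m. of_nat m * fps_X ^ (m choose 2) / poch_plus m)"
    by (simp only: R weighted sigma_mex_gf)
  show "?R * (\<Sum>m. of_nat m * fps_X ^ (m choose 2) / poch_plus m) =
      overpartition_gf * ramanujan_sigma"
    by (simp only: R weighted overpartition_gf_eq)
qed

end
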